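(* Let $n$ be a positive integer, written $n=p_1^{k_1}\cdots p_{\omega(n)}^{k_{\omega(n)}}$ with distinct primes $p_i$ and $k_i\in\mathbb{N}$, and let $f=\Phi_n$ be the $n$-th cyclotomic polynomial. Then for all indices $1\le i,j\le \varphi(n)$, \[ (M_f^\dagger M_f)_{ij}=\begin{cases} \varphi(n) & \text{if } i=j,\\ 0 & \text{if } \frac{n}{\operatorname{rad}(n)}\nmid i-j,\\ (-1)^{\omega(n)+\omega(d)}\left(\frac{n}{\operatorname{rad}(n)}\right)\varphi(\operatorname{rad}(d)) & \text{if } i\neq j \text{ and } \frac{n}{\operatorname{rad}(n)}\mid i-j, \end{cases} \] where $d=\gcd\!\left(\frac{i-j}{n/\operatorname{rad}(n)},\,n\right)$.
   Context: For a monic polynomial $f\in\mathbb{Z}[x]$ of degree $m$ with distinct complex roots $\alpha_1,\dots,\alpha_m$, $M_f$ denotes the $m\times m$ Vandermonde matrix with $(i,j)$ entry $\alpha_i^{\,j-1}$, and $M_f^\dagger$ its conjugate transpose. $\Phi_n$ is the $n$-th cyclotomic polynomial (degree $\varphi(n)$, $\varphi$ Euler's totient function). $\omega(m)$ is the number of distinct prime divisors of $m$, and $\operatorname{rad}(m)$ is the product of the distinct primes dividing $m$. *)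

theory Defs
  imports
    Complex_Main
    "HOL-Number_Theory.Number_Theory"
    "HOL-Computational_Algebra.Computational_Algebra"
    "Jordan_Normal_Form.Schur_Decomposition"
begin

definition omega :: "nat \<Rightarrow> nat" where
  "omega n = card (prime_factors n)"

definition rad :: "nat \<Rightarrow> nat" where
  "rad n = \<Prod>(prime_factors n)"

definition primitive_roots_unity :: "nat \<Rightarrow> complex set" where
  "primitive_roots_unity n = {z. z ^ n = 1 \<and> (\<forall>k. 0 < k \<and> k < n \<longrightarrow> z ^ k \<noteq> 1)}"

text \<open>
  Existence and uniqueness of this polynomial for positive \<open>n\<close> is
  \<open>of_int_poly_cyclotomic\<close> below. At \<open>n = 0\<close> the value is meaningless.
\<close>

definition cyclotomic :: "nat \<Rightarrow> int poly" where
  "cyclotomic n =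
     (THE f. (of_int_poly f :: complex poly) = (\<Prod>z\<in>primitive_roots_unity n. [:-z, 1:]))"

definition root_enumeration :: "int poly \<Rightarrow> complex list \<Rightarrow> bool" where
  "root_enumeration f \<alpha>s \<longleftrightarrow>
     length \<alpha>s = degree f \<and> distinct \<alpha>s \<and> set \<alpha>s = {z. poly (of_int_poly f) z = 0}"

text \<open>
  Row and column indices of matrices start at 0, so the exponent is \<open>j\<close> and not \<open>j - 1\<close>.
\<close>

definition vandermonde_mat :: "complex list \<Rightarrow> complex mat" where
  "vandermonde_mat \<alpha>s = mat (length \<alpha>s) (length \<alpha>s) (\<lambda>(i, j). (\<alpha>s ! i) ^ j)"

lemma finite_primitive_roots_unity:
  assumes "n > 0"
  shows "finite (primitive_roots_unity n)"
  by (rule finite_subset[OF _ finite_nth_roots[OF assms, of 1]])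
     (auto simp: primitive_roots_unity_def)

lemma roots_unity_eq_Union:
  assumes n: "n > 0"
  shows "{z :: complex. z ^ n = 1} = (\<Union>d\<in>{d. d dvd n}. primitive_roots_unity d)"
proof (intro equalityI subsetI)
  fix z :: complex assume "z \<in> {z. z ^ n = 1}"
  then have z: "z ^ n = 1" by simp
  define d where "d = (LEAST d. 0 < d \<and> z ^ d = 1)"
  have d: "0 < d \<and> z ^ d = 1"
    unfolding d_def by (rule LeastI[of _ n]) (use n z in simp)
  have min: "z ^ k \<noteq> 1" if "0 < k" "k < d" for k
    using not_less_Least[of k "\<lambda>d. 0 < d \<and> z ^ d = 1"] that unfolding d_def by auto
  have "z ^ n = z ^ (d * (n div d) + n mod d)" by simp
  also have "\<dots> = z ^ (n mod d)" using d by (simp only: power_add power_mult) simp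
  finally have "z ^ (n mod d) = 1" using z by simp
  moreover have "n mod d < d" using d by simp
  ultimately have "n mod d = 0" using min by blast
  then have "d dvd n" by auto
  then show "z \<in> (\<Union>d\<in>{d. d dvd n}. primitive_roots_unity d)"
    using d min by (auto simp: primitive_roots_unity_def)
next
  fix z assume "z \<in> (\<Union>d\<in>{d. d dvd n}. primitive_roots_unity d)"
  then show "z \<in> {z. z ^ n = 1}"
    by (auto simp: primitive_roots_unity_def power_mult elim!: dvdE)
qed

lemma primitive_roots_unity_disjoint:
  assumes "0 < m" "0 < n" "m \<noteq> n"
  shows "primitive_roots_unity m \<inter> primitive_roots_unity n = {}"
proof (rule ccontr)
  assume "primitive_roots_unity m \<inter> primitive_roots_unity n \<noteq> {}"
  then obtain z where z: "z \<in> primitive_roots_unity m" "z \<in> primitive_roots_unity n" by blast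
  have "m < n \<or> n < m" using assms(3) by linarith
  then show False using z assms(1,2) unfolding primitive_roots_unity_def by blast
qed

lemma monom_minus_1_eq_prod:
  assumes n: "n > 0"
  shows "monom 1 n - 1 = (\<Prod>z | z ^ n = 1. [:-z, 1 :: complex:])"
proof -
  let ?p = "monom 1 n - 1 :: complex poly"
  have rsq: "rsquarefree ?p"
    unfolding rsquarefree_roots
  proof (intro allI notI)
    fix a assume a: "poly ?p a = 0 \<and> poly (pderiv ?p) a = 0"
    then have "a ^ n = 1" "of_nat n * a ^ (n - 1) = 0"
      by (auto simp: poly_monom pderiv_diff pderiv_monom)
    then show False using n by (cases "a = 0") (auto simp: power_0_left)
  qed
  have deg: "degree ?p = n"
    using n by (intro antisym degree_le le_degree) (auto simp: coeff_monom)
  then have "lead_coeff ?p = 1" using n by (simp add: coeff_monom)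
  then show ?thesis
    using complex_poly_decompose_rsquarefree[OF rsq] by (simp add: poly_monom)
qed

lemma monom_minus_1_eq_prod_primitive:
  assumes n: "n > 0"
  shows "monom 1 n - 1 =
    (\<Prod>d | d dvd n. \<Prod>z\<in>primitive_roots_unity d. [:-z, 1 :: complex:])"
  unfolding monom_minus_1_eq_prod[OF n] roots_unity_eq_Union[OF n]
proof (rule prod.UNION_disjoint)
  show "finite {d. d dvd n}" using n by simp
  show "\<forall>d\<in>{d. d dvd n}. finite (primitive_roots_unity d)"
    using n by (auto intro!: finite_primitive_roots_unity dest: dvd_pos_nat)
  show "\<forall>d\<in>{d. d dvd n}. \<forall>e\<in>{d. d dvd n}. d \<noteq> e \<longrightarrow>
      primitive_roots_unity d \<inter> primitive_roots_unity e = {}"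
    using primitive_roots_unity_disjoint dvd_pos_nat[OF n] by blast
qed

lemma monic_prod_linear: "monic (\<Prod>z\<in>A. [:-z, 1 :: complex:])"
  by (rule monic_prod) auto

lemma cyclotomic_exists:
  assumes "n > 0"
  shows "\<exists>f. (of_int_poly f :: complex poly) = (\<Prod>z\<in>primitive_roots_unity n. [:-z, 1:])"
  using assms
proof (induction n rule: less_induct)
  case (less n)
  let ?D = "{d. d dvd n \<and> d \<noteq> n}"
  let ?C = "\<lambda>d. \<Prod>z\<in>primitive_roots_unity d. [:-z, 1 :: complex:]"
  have fin: "finite ?D" by (rule finite_subset[of _ "{d. d dvd n}"]) (use less.prems in auto)
  have "\<forall>d\<in>?D. \<exists>f. of_int_poly f = ?C d"
    using less.prems by (auto intro!: less.IH dest: dvd_pos_nat dvd_imp_le)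
  then obtain F where F: "\<And>d. d \<in> ?D \<Longrightarrow> of_int_poly (F d) = ?C d" by metis
  define P where "P = (\<Prod>d\<in>?D. F d)"
  have P: "of_int_poly P = (\<Prod>d\<in>?D. ?C d)"
    unfolding P_def of_int_poly_hom.hom_prod by (rule prod.cong) (auto simp: F)
  have monP: "monic (of_int_poly P :: complex poly)"
    unfolding P by (intro monic_prod monic_prod_linear)
  then have lcP: "lead_coeff P = 1" by simp
  then have P0: "P \<noteq> 0" by auto
  let ?X = "monom 1 n - 1 :: int poly"
  obtain q r where qr: "pseudo_divmod ?X P = (q, r)" by (meson surj_pair)
  have X: "?X = P * q + r" using pseudo_divmod(1)[OF P0 qr] lcP by simp
  have r: "r = 0 \<or> degree r < degree P" by (rule pseudo_divmod(2)[OF P0 qr])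
  have D: "{d. d dvd n} = insert n ?D" by auto
  have "of_int_poly ?X = (monom 1 n - 1 :: complex poly)"
    by (simp add: hom_distribs)
  also have "\<dots> = ?C n * of_int_poly P"
    unfolding monom_minus_1_eq_prod_primitive[OF less.prems] D P
    by (subst prod.insert) (use fin in auto)
  finally have eq: "of_int_poly P * of_int_poly q + of_int_poly r = ?C n * of_int_poly P"
    unfolding X by (simp add: hom_distribs)
  then have eq': "of_int_poly r = of_int_poly P * (?C n - of_int_poly q)"
    by (simp add: algebra_simps)
  have "?C n - of_int_poly q = 0"
  proof (rule ccontr)
    assume nz: "?C n - of_int_poly q \<noteq> 0"
    have P0': "(of_int_poly P :: complex poly) \<noteq> 0" using P0 by simp
    have "r \<noteq> 0" using eq' nz P0' by auto
    moreover have "degree (of_int_poly r :: complex poly) \<ge> degree (of_int_poly P :: complex poly)"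
      unfolding eq' by (subst degree_mult_eq[OF P0' nz]) simp
    ultimately show False using r by simp
  qed
  then show ?case by (intro exI[of _ q]) simp
qed

lemma of_int_poly_cyclotomic:
  assumes "n > 0"
  shows "(of_int_poly (cyclotomic n) :: complex poly) =
    (\<Prod>z\<in>primitive_roots_unity n. [:-z, 1:])"
proof -
  obtain f where f: "(of_int_poly f :: complex poly) = (\<Prod>z\<in>primitive_roots_unity n. [:-z, 1:])"
    using cyclotomic_exists[OF assms] by blast
  show ?thesis
    unfolding cyclotomic_def
  proof (rule theI[of _ f])
    fix g assume "of_int_poly g = (\<Prod>z\<in>primitive_roots_unity n. [:-z, 1 :: complex:])"
    then have "(of_int_poly g :: complex poly) = of_int_poly f" using f by metis
    then show "g = f" by simp
  qed (rule f)
qed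

lemma monic_cyclotomic:
  assumes "n > 0"
  shows "monic (cyclotomic n)"
proof -
  have "monic (of_int_poly (cyclotomic n) :: complex poly)"
    unfolding of_int_poly_cyclotomic[OF assms] by (rule monic_prod_linear)
  then show ?thesis by simp
qed

lemma roots_cyclotomic:
  assumes "n > 0"
  shows "{z. poly (of_int_poly (cyclotomic n)) z = 0} = primitive_roots_unity n"
  unfolding of_int_poly_cyclotomic[OF assms]
  by (auto simp: poly_prod finite_primitive_roots_unity[OF assms])

lemma root_enumeration_cyclotomic_exists:
  assumes "n > 0"
  shows "\<exists>\<alpha>s. root_enumeration (cyclotomic n) \<alpha>s"
proof -
  obtain \<alpha>s where \<alpha>s: "set \<alpha>s = primitive_roots_unity n" "distinct \<alpha>s"
    using finite_distinct_list[OF finite_primitive_roots_unity[OF assms]] by blast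
  have "degree (of_int_poly (cyclotomic n) :: complex poly) = card (primitive_roots_unity n)"
    unfolding of_int_poly_cyclotomic[OF assms] by (subst degree_prod_eq_sum_degree) auto
  then have "length \<alpha>s = degree (cyclotomic n)"
    using distinct_card[OF \<alpha>s(2)] \<alpha>s(1) by simp
  then show ?thesis using \<alpha>s roots_cyclotomic[OF assms] by (auto simp: root_enumeration_def)
qed

end

theory Submission
  imports Defs
begin

text \<open>
  Entry \<open>(i, j)\<close> of the Gram matrix is the Ramanujan sum \<open>c\<^sub>n(\<bar>i - j\<bar>)\<close>, because the
  roots of \<open>\<Phi>\<^sub>n\<close> lie on the unit circle. For fixed \<open>k\<close>, \<open>c\<^sub>n(k)\<close> is multiplicative in \<open>n\<close>, and at
  a prime power it is a difference of two sums over all roots of unity. Multiplying the local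
  factors gives the closed form; at \<open>k = 0\<close> they also give \<open>deg \<Phi>\<^sub>n = \<phi>(n)\<close>.
\<close>

section \<open>Orders of roots of unity\<close>

definition ramanujan_sum :: "nat \<Rightarrow> nat \<Rightarrow> complex" where
  "ramanujan_sum n k = (\<Sum>z\<in>primitive_roots_unity n. z ^ k)"

lemma power_eq_if_cong:
  fixes z :: "'a :: monoid_mult"
  assumes "z ^ n = 1" "[a = b] (mod n)"
  shows "z ^ a = z ^ b"
proof -
  have "z ^ c = z ^ (c mod n)" for c
  proof -
    have "z ^ c = z ^ (n * (c div n) + c mod n)" by simp
    also have "\<dots> = z ^ (c mod n)"
      using assms(1) by (simp only: power_add power_mult) simp
    finally show ?thesis .
  qed
  then show ?thesis using assms(2) unfolding cong_def by metis
qed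

text \<open>Reducing an exponent modulo \<open>n\<close> leaves one below \<open>n\<close>, and
  minimality forces it to be 0. The quantified form turns primitivity of powers and products into
  divisibility questions.\<close>

lemma primitive_roots_unity_iff:
  assumes "n > 0"
  shows "z \<in> primitive_roots_unity n \<longleftrightarrow> (\<forall>k. z ^ k = 1 \<longleftrightarrow> n dvd k)"
proof
  assume z: "z \<in> primitive_roots_unity n"
  then have zn: "z ^ n = 1" by (simp add: primitive_roots_unity_def)
  have "z ^ k = 1 \<longleftrightarrow> n dvd k" for k
  proof
    assume "z ^ k = 1"
    then have "z ^ (k mod n) = 1"
      using power_eq_if_cong[OF zn, of "k mod n" k] by (simp add: cong_def)
    moreover have "k mod n < n" using assms by simp
    moreover have "z ^ j \<noteq> 1" if "j > 0" "j < n" for j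
      using z that by (simp add: primitive_roots_unity_def)
    ultimately have "k mod n = 0" by (metis gr_zeroI)
    then show "n dvd k" by (rule mod_0_imp_dvd)
  qed (use zn in \<open>auto simp: power_mult elim!: dvdE\<close>)
  then show "\<forall>k. z ^ k = 1 \<longleftrightarrow> n dvd k" by blast
next
  assume "\<forall>k. z ^ k = 1 \<longleftrightarrow> n dvd k"
  then show "z \<in> primitive_roots_unity n"
    by (auto simp: primitive_roots_unity_def dest: nat_dvd_not_less)
qed

section \<open>Multiplicativity of Ramanujan sums\<close>

text \<open>The inverse map is \<open>z |-> (z ^ e, z ^ f)\<close> with \<open>e\<close> and
  \<open>f\<close> the Chinese remainder idempotents: \<open>e\<close> is 1 modulo \<open>m\<close>
  and 0 modulo \<open>n\<close>, and \<open>f\<close> the reverse. Thus raising a product to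
  \<open>e\<close> keeps its \<open>m\<close>-part and kills its \<open>n\<close>-part.\<close>

lemma bij_betw_primitive_roots_unity_mult:
  assumes "m > 0" "n > 0" "coprime m n"
  shows "bij_betw (\<lambda>(x, y). x * y)
    (primitive_roots_unity m \<times> primitive_roots_unity n) (primitive_roots_unity (m * n))"
proof -
  have mn: "m * n > 0" using assms by simp
  obtain e where e: "[e = 1] (mod m)" "[e = 0] (mod n)"
    using binary_chinese_remainder_nat[OF assms(3)] by blast
  obtain f where f: "[f = 0] (mod m)" "[f = 1] (mod n)"
    using binary_chinese_remainder_nat[OF assms(3)] by blast
  have ef: "[e + f = 1] (mod (m * n))"
    using cong_add[OF e(1) f(1)] cong_add[OF e(2) f(2)] assms(3)
    by (intro coprime_cong_mult_nat) auto
  have em: "coprime e m" and fn: "coprime f n"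
    using e(1) f(2) by (metis cong_imp_coprime cong_sym coprime_1_left)+
  have xy_e: "(x * y) ^ e = x" and xy_f: "(x * y) ^ f = y"
    if "x ^ m = 1" "y ^ n = 1" for x y :: complex
  proof -
    show "(x * y) ^ e = x"
      using power_eq_if_cong[OF that(1) e(1)] power_eq_if_cong[OF that(2) e(2)]
      by (simp add: power_mult_distrib)
    show "(x * y) ^ f = y"
      using power_eq_if_cong[OF that(1) f(1)] power_eq_if_cong[OF that(2) f(2)]
      by (simp add: power_mult_distrib)
  qed
  have comp: "z ^ e \<in> primitive_roots_unity m" "z ^ f \<in> primitive_roots_unity n"
    "z ^ e * z ^ f = z" if "z \<in> primitive_roots_unity (m * n)" for z
  proof -
    have z: "z ^ k = 1 \<longleftrightarrow> m * n dvd k" for k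
      using that primitive_roots_unity_iff[OF mn] by blast
    \<comment> \<open>The exponent \<open>e\<close> supplies the factor \<open>n\<close> and is a
      unit modulo \<open>m\<close>, so \<open>z ^ e\<close> has order exactly \<open>m\<close>. The
      argument for \<open>f\<close> is symmetric.\<close>
    have "m * n dvd e * k \<longleftrightarrow> m dvd k" for k
    proof
      assume "m * n dvd e * k"
      then have "m dvd e * k" by (rule dvd_mult_left)
      then show "m dvd k" using em by (simp add: coprime_commute coprime_dvd_mult_right_iff)
    next
      assume "m dvd k"
      moreover have "n dvd e" using e(2) by (simp add: cong_0_iff)
      ultimately show "m * n dvd e * k" by (metis mult.commute mult_dvd_mono)
    qed
    then show "z ^ e \<in> primitive_roots_unity m"
      using assms(1) by (simp add: primitive_roots_unity_iff z flip: power_mult)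
    have "m * n dvd f * k \<longleftrightarrow> n dvd k" for k
    proof
      assume "m * n dvd f * k"
      then have "n dvd f * k" by (rule dvd_mult_right)
      then show "n dvd k" using fn by (simp add: coprime_commute coprime_dvd_mult_right_iff)
    next
      assume "n dvd k"
      moreover have "m dvd f" using f(1) by (simp add: cong_0_iff)
      ultimately show "m * n dvd f * k" by (metis mult_dvd_mono)
    qed
    then show "z ^ f \<in> primitive_roots_unity n"
      using assms(2) by (simp add: primitive_roots_unity_iff z flip: power_mult)
    show "z ^ e * z ^ f = z"
      using power_eq_if_cong[OF _ ef, of z] z[of "m * n"] by (simp add: power_add)
  qed
  have prod: "x * y \<in> primitive_roots_unity (m * n)"
    if "x \<in> primitive_roots_unity m" "y \<in> primitive_roots_unity n" for x y
  proof -
    have x: "x ^ k = 1 \<longleftrightarrow> m dvd k" and y: "y ^ k = 1 \<longleftrightarrow> n dvd k" for k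
      using that primitive_roots_unity_iff assms by blast+
    have "(x * y) ^ k = 1 \<longleftrightarrow> m * n dvd k" for k
    proof
      assume k: "(x * y) ^ k = 1"
      \<comment> \<open>Each factor is a power of the product, so an exponent that sends the product
        to 1 does the same to both factors.\<close>
      have "x ^ k = ((x * y) ^ e) ^ k" "y ^ k = ((x * y) ^ f) ^ k"
        using xy_e[of x y] xy_f[of x y] x y by simp_all
      then have "x ^ k = 1" "y ^ k = 1"
        using k by (metis mult.commute power_mult power_one)+
      then show "m * n dvd k" using x y assms(3) by (simp add: divides_mult)
    next
      assume "m * n dvd k"
      then have "x ^ k = 1" "y ^ k = 1"
        unfolding x y by (auto dest: dvd_mult_left dvd_mult_right)
      then show "(x * y) ^ k = 1" by (simp add: power_mult_distrib)
    qed
    then show ?thesis by (simp add: primitive_roots_unity_iff[OF mn])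
  qed
  have root: "x ^ m = 1" if "x \<in> primitive_roots_unity m" for x m
    using that by (simp add: primitive_roots_unity_def)
  show ?thesis
  proof (rule bij_betw_byWitness[where f' = "\<lambda>z. (z ^ e, z ^ f)"])
    show "\<forall>a\<in>primitive_roots_unity m \<times> primitive_roots_unity n.
        ((case a of (x, y) \<Rightarrow> x * y) ^ e, (case a of (x, y) \<Rightarrow> x * y) ^ f) = a"
      by (clarsimp simp: xy_e[OF root root] xy_f[OF root root])
    show "\<forall>z\<in>primitive_roots_unity (m * n). (case (z ^ e, z ^ f) of (x, y) \<Rightarrow> x * y) = z"
      unfolding split_conv using comp(3) by blast
    show "(\<lambda>(x, y). x * y) ` (primitive_roots_unity m \<times> primitive_roots_unity n)
        \<subseteq> primitive_roots_unity (m * n)"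
      by (clarsimp simp only: image_subset_iff split_conv mem_Sigma_iff) (rule prod)
    show "(\<lambda>z. (z ^ e, z ^ f)) ` primitive_roots_unity (m * n)
        \<subseteq> primitive_roots_unity m \<times> primitive_roots_unity n"
      unfolding image_subset_iff using comp(1,2) by blast
  qed
qed

lemma ramanujan_sum_mult:
  assumes "m > 0" "n > 0" "coprime m n"
  shows "ramanujan_sum (m * n) k = ramanujan_sum m k * ramanujan_sum n k"
proof -
  have "ramanujan_sum (m * n) k =
      (\<Sum>(x, y)\<in>primitive_roots_unity m \<times> primitive_roots_unity n. (x * y) ^ k)"
    unfolding ramanujan_sum_def
    using sum.reindex_bij_betw[OF bij_betw_primitive_roots_unity_mult[OF assms], of "\<lambda>z. z ^ k"]
    by (simp add: case_prod_unfold)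
  also have "\<dots> = ramanujan_sum m k * ramanujan_sum n k"
    by (simp only: ramanujan_sum_def sum_product sum.cartesian_product power_mult_distrib)
  finally show ?thesis .
qed

lemma ramanujan_sum_1 [simp]: "ramanujan_sum 1 k = 1"
proof -
  have "primitive_roots_unity 1 = {1}" by (auto simp: primitive_roots_unity_def)
  then show ?thesis by (simp add: ramanujan_sum_def)
qed

lemma ramanujan_sum_prod:
  assumes "finite A" "\<And>a. a \<in> A \<Longrightarrow> f a > 0"
    and "\<And>a b. a \<in> A \<Longrightarrow> b \<in> A \<Longrightarrow> a \<noteq> b \<Longrightarrow> coprime (f a) (f b)"
  shows "ramanujan_sum (\<Prod>a\<in>A. f a) k = (\<Prod>a\<in>A. ramanujan_sum (f a) k)"
  using assms
proof (induction A rule: finite_induct)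
  case empty
  then show ?case using ramanujan_sum_1 by simp
next
  case (insert a A)
  have "coprime (f a) (\<Prod>a\<in>A. f a)"
    by (rule prod_coprime_right) (use insert in blast)
  moreover have "(\<Prod>a\<in>A. f a) > 0" by (intro prod_pos insert.prems(1) insertI2)
  ultimately have "ramanujan_sum (f a * (\<Prod>a\<in>A. f a)) k =
      ramanujan_sum (f a) k * ramanujan_sum (\<Prod>a\<in>A. f a) k"
    using insert.prems(1) by (intro ramanujan_sum_mult) blast+
  also have "ramanujan_sum (\<Prod>a\<in>A. f a) k = (\<Prod>a\<in>A. ramanujan_sum (f a) k)"
    by (intro insert.IH insert.prems insertI2)
  finally show ?case by (simp only: prod.insert[OF insert.hyps])
qed

section \<open>Sums over all roots of unity and the prime power case\<close>

text \<open>Multiplication by a primitive root \<open>\<zeta>\<close> permutes the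
  \<open>n\<close>-th roots of unity and scales the sum by \<open>\<zeta> ^ k\<close>. If
  \<open>n\<close> does not divide \<open>k\<close>, this factor differs from 1, so the sum
  vanishes.\<close>

lemma sum_power_roots_unity:
  assumes "n > 0"
  shows "(\<Sum>z | z ^ n = 1. z ^ k) = (if n dvd k then of_nat n else 0 :: complex)"
proof (cases "n dvd k")
  case True
  then obtain c where c: "k = n * c" by blast
  have "(\<Sum>z | z ^ n = 1. z ^ k) = (\<Sum>z | z ^ n = (1 :: complex). 1 :: complex)"
    by (rule sum.cong) (simp_all only: c power_mult mem_Collect_eq power_one)
  then show ?thesis using True assms by (simp add: card_roots_unity_eq)
next
  case False
  let ?f = "\<lambda>j. cis (2 * pi * real j / real n)"
  note bij = bij_betw_roots_unity[OF assms]
  define \<zeta> where "\<zeta> = ?f 1"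
  have pow: "\<zeta> ^ j = ?f j" for j by (simp add: \<zeta>_def DeMoivre mult_ac)
  have root: "\<zeta> ^ n = 1" using assms by (simp add: pow)
  have nz: "\<zeta> \<noteq> 0" by (simp add: \<zeta>_def)
  \<comment> \<open>The parametrisation of the roots is injective on indices below \<open>n\<close>,
    so the exponent is first brought into that range.\<close>
  have "\<zeta> ^ k = \<zeta> ^ (k mod n)"
    using power_eq_if_cong[OF root, of k "k mod n"] by (simp add: cong_def)
  moreover have "?f (k mod n) \<noteq> ?f 0"
  proof
    assume "?f (k mod n) = ?f 0"
    then have "k mod n = 0"
      by (rule inj_onD[OF bij_betw_imp_inj_on[OF bij]]) (use assms in simp_all)
    then show False using False by (simp add: dvd_eq_mod_eq_0)
  qed
  ultimately have ne: "\<zeta> ^ k \<noteq> 1" by (simp add: pow)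
  have "(\<Sum>z | z ^ n = 1. z ^ k) = (\<Sum>z | z ^ n = 1. (\<zeta> * z) ^ k)"
    by (rule sum.reindex_bij_witness[of _ "\<lambda>z. \<zeta> * z" "\<lambda>z. z / \<zeta>"])
       (simp_all add: power_mult_distrib power_divide root nz)
  also have "\<dots> = \<zeta> ^ k * (\<Sum>z | z ^ n = 1. z ^ k)"
    by (simp add: power_mult_distrib sum_distrib_left)
  finally show ?thesis using ne False by simp
qed

text \<open>The divisors of \<open>p ^ Suc a\<close> form a chain, so an order that divides
  \<open>p ^ Suc a\<close> but not \<open>p ^ a\<close> can only be
  \<open>p ^ Suc a\<close>.\<close>

lemma primitive_roots_unity_prime_power:
  assumes "prime p"
  shows "primitive_roots_unity (p ^ Suc a) = {z. z ^ p ^ Suc a = 1} - {z. z ^ p ^ a = 1}"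
proof -
  have p: "p > 1" using assms by (rule prime_gt_1_nat)
  have "(\<forall>k. z ^ k = 1 \<longleftrightarrow> p ^ Suc a dvd k) \<longleftrightarrow> z ^ p ^ Suc a = 1 \<and> z ^ p ^ a \<noteq> 1"
    for z :: complex
  proof
    assume *: "\<forall>k. z ^ k = 1 \<longleftrightarrow> p ^ Suc a dvd k"
    have "\<not> p ^ Suc a dvd p ^ a" using p by (simp add: power_dvd_imp_le dvd_power_iff)
    then show "z ^ p ^ Suc a = 1 \<and> z ^ p ^ a \<noteq> 1" using * by (metis dvd_refl)
  next
    assume z: "z ^ p ^ Suc a = 1 \<and> z ^ p ^ a \<noteq> 1"
    then obtain d where d: "d dvd p ^ Suc a" "z \<in> primitive_roots_unity d"
      using roots_unity_eq_Union[of "p ^ Suc a"] p by auto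
    then have "d > 0" using p by (metis dvd_pos_nat gr_zeroI power_not_zero not_one_less_zero)
    then have zd: "z ^ k = 1 \<longleftrightarrow> d dvd k" for k
      using d primitive_roots_unity_iff by blast
    obtain b where b: "b \<le> Suc a" "d = p ^ b"
      using divides_primepow_nat[OF assms, THEN iffD1, OF d(1)] by (elim exE conjE)
    have "\<not> b \<le> a"
    proof
      assume "b \<le> a"
      then have "d dvd p ^ a" unfolding b(2) by (rule le_imp_power_dvd)
      then show False using z zd by metis
    qed
    then have "b = Suc a" using b(1) by simp
    then show "\<forall>k. z ^ k = 1 \<longleftrightarrow> p ^ Suc a dvd k" using zd b(2) by metis
  qed
  moreover have pos: "p ^ Suc a > 0" using p by simp
  ultimately have "z \<in> primitive_roots_unity (p ^ Suc a) \<longleftrightarrow> z ^ p ^ Suc a = 1 \<and> z ^ p ^ a \<noteq> 1"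
    for z
    unfolding primitive_roots_unity_iff[OF pos] by simp
  then show ?thesis by blast
qed

text \<open>The difference of the full sums for \<open>p ^ Suc a\<close> and \<open>p ^ a\<close>.
  The factor \<open>p ^ a\<close> is pulled out because these factors later multiply to
  \<open>n div rad n\<close>, leaving only \<open>p - 1\<close>, -1 or 0 at each prime.\<close>

lemma ramanujan_sum_prime_power:
  assumes "prime p"
  shows "ramanujan_sum (p ^ Suc a) k = of_nat (p ^ a) *
    (if p ^ Suc a dvd k then of_nat (p - 1) else if p ^ a dvd k then - 1 else 0)"
proof -
  have p: "p > 1" using assms by (rule prime_gt_1_nat)
  have "{z :: complex. z ^ p ^ a = 1} \<subseteq> {z. z ^ p ^ Suc a = 1}"
    by (intro subsetI) (simp only: mem_Collect_eq power_Suc2 power_mult power_one)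
  then have "ramanujan_sum (p ^ Suc a) k =
      (\<Sum>z | z ^ p ^ Suc a = 1. z ^ k) - (\<Sum>z | z ^ p ^ a = 1. z ^ k)"
    unfolding ramanujan_sum_def primitive_roots_unity_prime_power[OF assms]
    using p by (intro sum_diff) (auto intro!: finite_nth_roots)
  also have "\<dots> = (if p ^ Suc a dvd k then of_nat (p ^ Suc a) else 0) -
      (if p ^ a dvd k then of_nat (p ^ a) else 0)"
    using p by (simp only: sum_power_roots_unity zero_less_power)
  finally have eq: "ramanujan_sum (p ^ Suc a) k =
      (if p ^ Suc a dvd k then of_nat (p ^ Suc a) else 0) -
      (if p ^ a dvd k then of_nat (p ^ a) else 0)" .
  have "p ^ a dvd k" if "p ^ Suc a dvd k"
    using that by (simp add: dvd_mult_right)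
  then show ?thesis unfolding eq using p by (auto simp: of_nat_diff algebra_simps)
qed

section \<open>Products over the prime factors of \<open>n\<close>\<close>

lemma coprime_prime_factors:
  fixes p q n :: nat
  assumes "p \<in> prime_factors n" "q \<in> prime_factors n" "p \<noteq> q"
  shows "coprime p q"
  using assms by (auto intro: primes_coprime_nat)

lemma rad_pos: "rad n > 0"
  unfolding rad_def by (intro prod_pos) (auto intro: prime_gt_0_nat)

lemma totient_rad: "totient (rad n) = (\<Prod>p\<in>prime_factors n. p - 1)"
proof -
  have "totient (rad n) = (\<Prod>p\<in>prime_factors n. totient p)"
    unfolding rad_def
    by (rule totient_prod_coprime) (auto simp: pairwise_def coprime_prime_factors)
  also have "\<dots> = (\<Prod>p\<in>prime_factors n. p - 1)"
    by (intro prod.cong refl) (simp add: totient_prime in_prime_factors_imp_prime)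
  finally show ?thesis .
qed

lemma div_rad_eq_prod:
  assumes "n > 0"
  shows "n div rad n = (\<Prod>p\<in>prime_factors n. p ^ (multiplicity p n - 1))"
proof -
  have "n = (\<Prod>p\<in>prime_factors n. p ^ multiplicity p n)"
    using assms by (rule prime_factorization_nat)
  \<comment> \<open>Every prime factor has positive multiplicity, so the truncated subtraction is
    exact and one factor \<open>p\<close> splits off.\<close>
  also have "\<dots> = (\<Prod>p\<in>prime_factors n. p ^ (multiplicity p n - 1) * p)"
    by (intro prod.cong refl)
       (auto simp: prime_factors_multiplicity simp flip: power_Suc2)
  also have "\<dots> = (\<Prod>p\<in>prime_factors n. p ^ (multiplicity p n - 1)) * rad n"
    by (simp add: prod.distrib rad_def)
  finally show ?thesis using rad_pos[of n] by (metis div_mult_self_is_m)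
qed

text \<open>The prime powers in the factorisation of \<open>n\<close> are pairwise coprime, so
  multiplicativity gives a product of local factors. All three cases of the theorem are read off
  from it.\<close>

lemma ramanujan_sum_eq_prod:
  assumes "n > 0"
  shows "ramanujan_sum n k = (\<Prod>p\<in>prime_factors n. of_nat (p ^ (multiplicity p n - 1)) *
    (if p ^ multiplicity p n dvd k then of_nat (p - 1)
     else if p ^ (multiplicity p n - 1) dvd k then - 1 else 0))"
proof -
  have "ramanujan_sum n k = ramanujan_sum (\<Prod>p\<in>prime_factors n. p ^ multiplicity p n) k"
    using prime_factorization_nat[OF assms] by simp
  also have "\<dots> = (\<Prod>p\<in>prime_factors n. ramanujan_sum (p ^ multiplicity p n) k)"
    by (intro ramanujan_sum_prod) (auto simp: prime_gt_0_nat in_prime_factors_imp_prime coprime_prime_factors)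
  also have "\<dots> = (\<Prod>p\<in>prime_factors n. of_nat (p ^ (multiplicity p n - 1)) *
    (if p ^ multiplicity p n dvd k then of_nat (p - 1)
     else if p ^ (multiplicity p n - 1) dvd k then - 1 else 0))"
  proof (intro prod.cong refl)
    fix p assume "p \<in> prime_factors n"
    then have "prime p" "Suc (multiplicity p n - 1) = multiplicity p n"
      by (auto simp: prime_factors_multiplicity)
    then show "ramanujan_sum (p ^ multiplicity p n) k = of_nat (p ^ (multiplicity p n - 1)) *
        (if p ^ multiplicity p n dvd k then of_nat (p - 1)
         else if p ^ (multiplicity p n - 1) dvd k then - 1 else 0)"
      using ramanujan_sum_prime_power[of p "multiplicity p n - 1" k] by simp
  qed
  finally show ?thesis .
qed

text \<open>At \<open>k = 0\<close> every divisibility test succeeds, and the local factors multiply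
  to the product formula for the totient. This gives both the size of the Gram matrix and its
  diagonal.\<close>

lemma card_primitive_roots_unity:
  assumes "n > 0"
  shows "card (primitive_roots_unity n) = totient n"
proof -
  have "of_nat (card (primitive_roots_unity n)) = ramanujan_sum n 0"
    by (simp add: ramanujan_sum_def)
  also have "\<dots> = of_nat (totient n)"
    by (simp add: ramanujan_sum_eq_prod[OF assms] totient_formula1[OF assms])
  finally show ?thesis by (simp only: of_nat_eq_iff)
qed

section \<open>Vanishing and closed form\<close>

lemma prod_dvd_if_coprime:
  fixes f :: "'a \<Rightarrow> 'b :: semiring_gcd"
  assumes "finite A" "\<And>a. a \<in> A \<Longrightarrow> f a dvd k"
    and "\<And>a b. a \<in> A \<Longrightarrow> b \<in> A \<Longrightarrow> a \<noteq> b \<Longrightarrow> coprime (f a) (f b)"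
  shows "(\<Prod>a\<in>A. f a) dvd k"
  using assms
proof (induction A rule: finite_induct)
  case (insert a A)
  have "coprime (f a) (\<Prod>a\<in>A. f a)"
    by (rule prod_coprime_right) (use insert in blast)
  moreover have "(\<Prod>a\<in>A. f a) dvd k"
    by (intro insert.IH insert.prems insertI2)
  ultimately show ?case
    using insert.prems(1)[of a] by (simp add: prod.insert[OF insert.hyps] divides_mult)
qed simp

text \<open>Since \<open>n div rad n\<close> is a product of pairwise coprime prime powers, one of
  them fails to divide \<open>k\<close>. The local factor at that prime is 0.\<close>

lemma ramanujan_sum_eq_0:
  assumes "n > 0" "\<not> n div rad n dvd k"
  shows "ramanujan_sum n k = 0"
proof -
  have "\<exists>p\<in>prime_factors n. \<not> p ^ (multiplicity p n - 1) dvd k"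
  proof (rule ccontr)
    assume "\<not> ?thesis"
    then have "n div rad n dvd k"
      unfolding div_rad_eq_prod[OF assms(1)]
      by (intro prod_dvd_if_coprime) (auto simp: coprime_prime_factors)
    then show False using assms(2) by contradiction
  qed
  then obtain p where p: "p \<in> prime_factors n" "\<not> p ^ (multiplicity p n - 1) dvd k"
    by blast
  then have "\<not> p ^ multiplicity p n dvd k"
    by (meson diff_le_self dvd_trans le_imp_power_dvd)
  then show ?thesis
    unfolding ramanujan_sum_eq_prod[OF assms(1)] using p by (intro prod_zero) auto
qed

text \<open>For exponents \<open>s * t\<close> no local factor vanishes: besides its power of
  \<open>p\<close>, a prime of \<open>n\<close> contributes \<open>p - 1\<close> if it divides
  \<open>t\<close> and -1 otherwise. The primes of the first kind are those of \<open>d\<close> and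
  yield \<open>totient (rad d)\<close>; the others yield the sign.\<close>

lemma ramanujan_sum_eq:
  fixes n t :: nat
  assumes "n > 0"
  defines "s \<equiv> n div rad n" and "d \<equiv> gcd t n"
  shows "ramanujan_sum n (s * t) =
    (-1) ^ (omega n + omega d) * of_nat s * of_nat (totient (rad d))"
proof -
  define A where "A = prime_factors n"
  define B where "B = prime_factors d"
  define a where "a p = multiplicity p n - 1" for p
  have [simp]: "finite A" by (simp add: A_def)
  have s: "s = (\<Prod>p\<in>A. p ^ a p)"
    by (simp add: s_def A_def a_def div_rad_eq_prod[OF assms(1)])
  have B: "B = {p\<in>A. p dvd t}"
    using assms(1) by (auto simp: A_def B_def d_def prime_factors_dvd)
  have fac: "of_nat (p ^ (multiplicity p n - 1)) *
      (if p ^ multiplicity p n dvd s * t then of_nat (p - 1)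
       else if p ^ (multiplicity p n - 1) dvd s * t then - 1 else 0) =
      (of_nat (p ^ a p) * (if p \<in> B then of_nat (p - 1) else - 1) :: complex)"
    if p: "p \<in> A" for p
  proof -
    have prime: "prime p" using p by (auto simp: A_def)
    have mult: "multiplicity p n = Suc (a p)"
      using p by (auto simp: A_def a_def prime_factors_multiplicity)
    define s' where "s' = (\<Prod>q\<in>A - {p}. q ^ a q)"
    have s': "s = p ^ a p * s'" using p by (simp add: s s'_def prod.remove)
    have "coprime p s'"
      \<comment> \<open>As \<open>p\<close> does not divide the cofactor \<open>s'\<close>, the
        multiplicity of \<open>p\<close> in \<open>s\<close> is exactly \<open>a p\<close>, and a
        further factor \<open>p\<close> has to come from \<open>t\<close>.\<close>
      unfolding s'_def by (rule prod_coprime_right)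
        (use p in \<open>auto simp: A_def coprime_prime_factors\<close>)
    then have "p ^ Suc (a p) dvd s * t \<longleftrightarrow> p dvd t"
      using prime prime_gt_0_nat[OF prime]
      by (simp add: s' mult.assoc coprime_dvd_mult_right_iff mult.commute[of p])
    then show ?thesis using p by (auto simp: mult B s' simp flip: a_def)
  qed
  have "B \<subseteq> A" by (auto simp: B)
  have cardA: "card A = card B + card (A - B)"
    using \<open>B \<subseteq> A\<close> by (simp add: card_Diff_subset finite_subset card_mono)
  have "ramanujan_sum n (s * t) =
      (\<Prod>p\<in>A. of_nat (p ^ a p) * (if p \<in> B then of_nat (p - 1) else - 1))"
    unfolding ramanujan_sum_eq_prod[OF assms(1)] using fac by (intro prod.cong) (auto simp: A_def)
  also have "\<dots> = of_nat s * (\<Prod>p\<in>A. if p \<in> B then of_nat (p - 1) else - 1)"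
    by (simp add: prod.distrib s)
  also have "(\<Prod>p\<in>A. if p \<in> B then of_nat (p - 1) else - 1 :: complex) =
      (\<Prod>p\<in>A \<inter> B. of_nat (p - 1)) * (\<Prod>p\<in>A \<inter> - B. - 1)"
    by (subst prod.If_cases) (auto simp: Int_def)
  also have "A \<inter> B = B" using \<open>B \<subseteq> A\<close> by blast
  also have "(\<Prod>p\<in>B. of_nat (p - 1)) = (of_nat (totient (rad d)) :: complex)"
    by (simp add: totient_rad B_def)
  \<comment> \<open>The number of factors -1 is \<open>omega n - omega d\<close>, which has the same
    parity as the sum.\<close>
  also have "(\<Prod>p\<in>A \<inter> - B. - 1 :: complex) = (-1) ^ (omega n + omega d)"
    using cardA by (simp add: omega_def power_add Diff_eq mult.assoc
      flip: A_def B_def mult_2 power_mult_distrib)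
  finally show ?thesis by (simp add: mult_ac)
qed

text \<open>Both the vanishing case and the closed form give an integer. This removes the conjugate
  that arises in entries below the diagonal.\<close>

lemma cnj_ramanujan_sum:
  assumes "n > 0"
  shows "cnj (ramanujan_sum n k) = ramanujan_sum n k"
proof (cases "n div rad n dvd k")
  case True
  then show ?thesis by (auto simp: ramanujan_sum_eq[OF assms] elim!: dvdE)
qed (simp add: ramanujan_sum_eq_0[OF assms])

section \<open>Gram matrix of the Vandermonde matrix\<close>

lemma norm_primitive_root_unity:
  assumes "n > 0" "z \<in> primitive_roots_unity n"
  shows "norm z = 1"
proof -
  have "norm z ^ n = 1 ^ n"
    using assms(2) by (simp add: primitive_roots_unity_def flip: norm_power)
  then show ?thesis by (rule power_eq_imp_eq_base) (use assms(1) in simp_all)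
qed

text \<open>On the unit circle conjugation is inversion, so the product is \<open>z\<close> to the
  power \<open>j - i\<close>. The case split keeps exponents natural, as
  \<open>ramanujan_sum\<close> expects.\<close>

lemma cnj_power_mult_power:
  assumes "norm z = 1"
  shows "cnj z ^ i * z ^ j = (if i \<le> j then z ^ (j - i) else cnj (z ^ (i - j)))"
proof -
  have z: "cnj z * z = 1" using assms by (simp add: mult.commute complex_norm_square[symmetric])
  show ?thesis
  proof (cases "i \<le> j")
    case True
    then have "cnj z ^ i * z ^ j = (cnj z * z) ^ i * z ^ (j - i)"
      by (simp add: power_mult_distrib mult.assoc flip: power_add)
    then show ?thesis using True z by simp
  next
    case False
    then have "cnj z ^ i * z ^ j = (cnj z * z) ^ j * cnj z ^ (i - j)"
      by (simp add: power_mult_distrib mult.commute mult.left_commute flip: power_add)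
    then show ?thesis using False z by simp
  qed
qed

text \<open>Distinctness makes list indexing a bijection onto the set of roots, so the entry does
  not depend on the order of the enumeration.\<close>

lemma vandermonde_gram_eq:
  assumes "distinct \<alpha>s" "i < length \<alpha>s" "j < length \<alpha>s"
  shows "(mat_adjoint (vandermonde_mat \<alpha>s) * vandermonde_mat \<alpha>s) $$ (i, j) =
    (\<Sum>z\<in>set \<alpha>s. cnj z ^ i * z ^ j)"
proof -
  let ?M = "vandermonde_mat \<alpha>s" and ?m = "length \<alpha>s"
  have "(mat_adjoint ?M * ?M) $$ (i, j) = (\<Sum>l<?m. cnj (\<alpha>s ! l) ^ i * (\<alpha>s ! l) ^ j)"
    using assms(2,3)
    by (auto simp: mat_adjoint_def vandermonde_mat_def scalar_prod_def
        mat_of_rows_def lessThan_atLeast0 intro!: sum.cong)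
  also have "\<dots> = (\<Sum>z\<in>set \<alpha>s. cnj z ^ i * z ^ j)"
    by (rule sum.reindex_bij_betw) (rule bij_betw_nth; use assms(1) in simp)
  finally show ?thesis .
qed

lemma vandermonde_gram_cyclotomic:
  assumes "n > 0" "root_enumeration (cyclotomic n) \<alpha>s" "i < totient n" "j < totient n"
  shows "(mat_adjoint (vandermonde_mat \<alpha>s) * vandermonde_mat \<alpha>s) $$ (i, j) =
    ramanujan_sum n (nat \<bar>int i - int j\<bar>)"
proof -
  have \<alpha>s: "distinct \<alpha>s" "set \<alpha>s = primitive_roots_unity n"
    using assms(2) roots_cyclotomic[OF assms(1)] by (auto simp: root_enumeration_def)
  \<comment> \<open>This count places all indices below \<open>totient n\<close> inside the
    matrix.\<close>
  then have len: "length \<alpha>s = totient n"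
    using distinct_card[of \<alpha>s] card_primitive_roots_unity[OF assms(1)] by simp
  have "(mat_adjoint (vandermonde_mat \<alpha>s) * vandermonde_mat \<alpha>s) $$ (i, j) =
      (\<Sum>z\<in>primitive_roots_unity n. cnj z ^ i * z ^ j)"
    using vandermonde_gram_eq[of \<alpha>s i j] \<alpha>s len assms(3,4) by simp
  also have "\<dots> = (\<Sum>z\<in>primitive_roots_unity n.
      if i \<le> j then z ^ (j - i) else cnj (z ^ (i - j)))"
    using norm_primitive_root_unity[OF assms(1)]
    by (intro sum.cong refl cnj_power_mult_power) auto
  also have "\<dots> = (if i \<le> j then ramanujan_sum n (j - i) else cnj (ramanujan_sum n (i - j)))"
    by (simp add: ramanujan_sum_def)
  also have "\<dots> = ramanujan_sum n (nat \<bar>int i - int j\<bar>)"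
    by (auto simp: cnj_ramanujan_sum[OF assms(1)] abs_if nat_diff_distrib' simp flip: of_nat_diff)
  finally show ?thesis .
qed

theorem theorem2:
  fixes n :: nat and \<alpha>s :: "complex list" and M :: "complex mat"
  assumes "n > 0"
    and "root_enumeration (cyclotomic n) \<alpha>s"
    and "M = vandermonde_mat \<alpha>s"
  shows "\<forall>i\<in>{1..totient n}. \<forall>j\<in>{1..totient n}.
    (let s = n div rad n;
         d = nat (gcd ((int i - int j) div int s) (int n))
     in (mat_adjoint M * M) $$ (i - 1, j - 1) =
          (if i = j then of_nat (totient n)
           else if \<not> int s dvd int i - int j then 0
           else (-1) ^ (omega n + omega d) * of_nat s * of_nat (totient (rad d))))"
proof (intro ballI)
  fix i j assume ij: "i \<in> {1..totient n}" "j \<in> {1..totient n}"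
  define s where "s = n div rad n"
  define d where "d = nat (gcd ((int i - int j) div int s) (int n))"
  define k where "k = nat \<bar>int i - int j\<bar>"
  have k: "int k = \<bar>int i - int j\<bar>" by (simp add: k_def)
  \<comment> \<open>Passing from one-based to zero-based indices preserves the difference; both
    indices are at least 1, so no subtraction truncates.\<close>
  have "int (i - 1) - int (j - 1) = int i - int j" using ij by auto
  then have gram: "(mat_adjoint M * M) $$ (i - 1, j - 1) = ramanujan_sum n k"
    using vandermonde_gram_cyclotomic[OF assms(1,2), of "i - 1" "j - 1"] ij assms(3)
    by (auto simp: k_def)
  have dvd: "int s dvd int i - int j \<longleftrightarrow> s dvd k"
    by (metis k dvd_abs_iff int_dvd_int_iff)
  have "ramanujan_sum n k = (-1) ^ (omega n + omega d) * of_nat s * of_nat (totient (rad d))"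
    if st: "s dvd k"
  proof -
    \<comment> \<open>The quotient \<open>t\<close> may be negative, but both \<open>d\<close> and
      \<open>k\<close> depend only on its absolute value.\<close>
    obtain t where t: "int i - int j = int s * t" using st dvd by auto
    have "s > 0"
      unfolding s_def div_rad_eq_prod[OF assms(1)]
      by (intro prod_pos) (auto intro: prime_gt_0_nat)
    then have "(int i - int j) div int s = t" by (simp add: t)
    then have d': "d = gcd (nat \<bar>t\<bar>) n"
      by (simp only: d_def gcd_int_def abs_of_nat nat_int)
    have "k = s * nat \<bar>t\<bar>" by (simp add: k_def t abs_mult nat_mult_distrib)
    then show ?thesis using ramanujan_sum_eq[OF assms(1), of "nat \<bar>t\<bar>"] by (simp add: d' s_def)
  qed
  moreover have "ramanujan_sum n k = 0" if "\<not> s dvd k"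
    using that ramanujan_sum_eq_0[OF assms(1)] by (simp add: s_def)
  moreover have "ramanujan_sum n k = of_nat (totient n)" if "i = j"
    using that card_primitive_roots_unity[OF assms(1)] by (simp add: k_def ramanujan_sum_def)
  ultimately have "(mat_adjoint M * M) $$ (i - 1, j - 1) =
          (if i = j then of_nat (totient n)
           else if \<not> int s dvd int i - int j then 0
           else (-1) ^ (omega n + omega d) * of_nat s * of_nat (totient (rad d)))"
    unfolding gram dvd by simp
  then show "let s = n div rad n;
         d = nat (gcd ((int i - int j) div int s) (int n))
     in (mat_adjoint M * M) $$ (i - 1, j - 1) =
          (if i = j then of_nat (totient n)
           else if \<not> int s dvd int i - int j then 0
           else (-1) ^ (omega n + omega d) * of_nat s * of_nat (totient (rad d)))"
    unfolding Let_def s_def d_def .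
qed

end
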